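(* Every graph $G$ (of arbitrary cardinality) that does not contain a ray linked disjointly to infinitely many vertices of infinite degree has an unfriendly partition. Equivalently: every graph not containing a comb all of whose teeth have infinite degree in $G$ has an unfriendly partition.
   Context: A ray is a one-way infinite path. A comb is the union of a ray $R$ with infinitely many pairwise disjoint finite paths, each having exactly its first vertex on $R$ (paths may be trivial); the last vertices of these paths are the teeth of the comb. "A ray linked disjointly to infinitely many vertices of infinite degree" means such a comb whose teeth all have infinite degree. A partition of a graph $G=(V,E)$ is a function $\pi: V\to\{0,1\}$. For a vertex $x$, a neighbour $y$ of $x$ is an opponent of $x$ if $\pi(y)\neq\pi(x)$ and a friend if $\pi(y)=\pi(x)$. A vertex is happy in $\pi$ if the (cardinal) number of its opponents is at least the number of its friends. A partition is unfriendly if every vertex is happy in it. *)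

theory Defs
  imports Main "HOL-Library.FuncSet"
begin

unbundle cardinal_syntax

definition simple_graph :: "'a set \<Rightarrow> 'a set set \<Rightarrow> bool" where
  "simple_graph V E \<longleftrightarrow> E \<subseteq> {{u, v} | u v. u \<in> V \<and> v \<in> V \<and> u \<noteq> v}"

definition neighbours :: "'a set set \<Rightarrow> 'a \<Rightarrow> 'a set" where
  "neighbours E x = {y. {x, y} \<in> E}"

definition infinite_degree :: "'a set set \<Rightarrow> 'a \<Rightarrow> bool" where
  "infinite_degree E x \<longleftrightarrow> infinite (neighbours E x)"

text \<open>A ray is given by the injective enumeration of its vertices from its first vertex on, a finite
  path by the list of its vertices; one-element lists are the trivial paths.\<close>

definition is_ray :: "'a set \<Rightarrow> 'a set set \<Rightarrow> (nat \<Rightarrow> 'a) \<Rightarrow> bool" where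
  "is_ray V E r \<longleftrightarrow> range r \<subseteq> V \<and> inj r \<and> (\<forall>n. {r n, r (Suc n)} \<in> E)"

definition is_path :: "'a set \<Rightarrow> 'a set set \<Rightarrow> 'a list \<Rightarrow> bool" where
  "is_path V E p \<longleftrightarrow>
     p \<noteq> [] \<and> set p \<subseteq> V \<and> distinct p \<and> successively (\<lambda>u v. {u, v} \<in> E) p"

text \<open>A comb is represented by its ray \<open>r\<close> together with its set \<open>P\<close> of paths, and not by the
  subgraph that is their union, since the teeth depend on this decomposition.\<close>

definition is_comb :: "'a set \<Rightarrow> 'a set set \<Rightarrow> (nat \<Rightarrow> 'a) \<Rightarrow> 'a list set \<Rightarrow> bool" where
  "is_comb V E r P \<longleftrightarrow>
     is_ray V E r \<and> infinite P \<and>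
     (\<forall>p\<in>P. is_path V E p \<and> set p \<inter> range r = {hd p}) \<and>
     (\<forall>p\<in>P. \<forall>q\<in>P. p \<noteq> q \<longrightarrow> set p \<inter> set q = {})"

definition teeth :: "'a list set \<Rightarrow> 'a set" where
  "teeth P = last ` P"

definition opponents :: "'a set set \<Rightarrow> ('a \<Rightarrow> nat) \<Rightarrow> 'a \<Rightarrow> 'a set" where
  "opponents E \<pi> x = {y \<in> neighbours E x. \<pi> y \<noteq> \<pi> x}"

definition friends :: "'a set set \<Rightarrow> ('a \<Rightarrow> nat) \<Rightarrow> 'a \<Rightarrow> 'a set" where
  "friends E \<pi> x = {y \<in> neighbours E x. \<pi> y = \<pi> x}"

definition happy :: "'a set set \<Rightarrow> ('a \<Rightarrow> nat) \<Rightarrow> 'a \<Rightarrow> bool" where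
  "happy E \<pi> x \<longleftrightarrow> |friends E \<pi> x| \<le>o |opponents E \<pi> x|"

definition unfriendly_partition :: "'a set \<Rightarrow> 'a set set \<Rightarrow> ('a \<Rightarrow> nat) \<Rightarrow> bool" where
  "unfriendly_partition V E \<pi> \<longleftrightarrow> \<pi> \<in> V \<rightarrow> {0, 1} \<and> (\<forall>x\<in>V. happy E \<pi> x)"

end

theory Submission
  imports Defs "HOL-Analysis.Function_Topology"
begin

text \<open>
  Call a set \<open>U\<close> of vertices solvable if every colouring of the outside of \<open>U\<close> extends to a
  colouring in which all vertices of \<open>U\<close> are happy and which is moreover optimal: recolouring
  finitely many finite-degree vertices of \<open>U\<close> never decreases the number of monochromatic
  edges. Sets without vertices of infinite degree are solvable by compactness.

  Suppose that all subsets of \<open>U - {s}\<close> are solvable, where \<open>s\<close> has infinite degree, and that \<open>s\<close> is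
  unhappy in an optimal colouring of \<open>U - {s}\<close>, having a set \<open>F\<close> of opponents with
  \<open>|F| < deg s\<close>. Flip \<open>s\<close>; only vertices of \<open>F\<close> can be harmed. If \<open>F\<close> is finite, optimality bounds the
  total improvement still available by \<open>2 |F|\<close>, so finitely many further flips restore optimality,
  and they do not affect the vertices of infinite degree. If \<open>F\<close> is infinite, close it off under
  neighbours inside the set of vertices of degree at most \<open>|F|\<close>: the closure has size at most \<open>|F|\<close>, so
  it can be recoloured without affecting vertices of larger degree. Hence \<open>U\<close> is solvable.

  So hereditary solvability passes from the components of \<open>W - S\<close>, with \<open>S\<close> finite, to \<open>W\<close>. If \<open>V\<close>
  were not hereditarily solvable, then one could repeatedly pick a bad component, delete from it a
  finite path to a vertex of infinite degree, and continue in a bad component of the remainder;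
  the deleted paths assemble to a comb whose teeth have infinite degree.
\<close>

section \<open>Compactness of the space of colourings\<close>

text \<open>By Tychonoff the space of all colourings is compact. If every \<open>c\<close> had a
  finite \<open>T c\<close> on which it differs from each \<open>f D\<close> with \<open>D\<close>
  finite and containing \<open>T c\<close>, then finitely many of the cylinders given by
  \<open>c\<close> on \<open>T c\<close> would cover the space, and the union of their supports
  would be a contradictory \<open>D\<close>.\<close>

lemma selection_compactness:
  fixes f :: "'a set \<Rightarrow> 'a \<Rightarrow> bool"
  shows "\<exists>c. \<forall>T. finite T \<longrightarrow> (\<exists>D. finite D \<and> T \<subseteq> D \<and> (\<forall>v\<in>T. c v = f D v))"
proof (rule ccontr)
  assume "\<not> ?thesis"
  then have "\<forall>c. \<exists>T. finite T \<and> (\<forall>D. finite D \<and> T \<subseteq> D \<longrightarrow> (\<exists>v\<in>T. c v \<noteq> f D v))"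
    by metis
  then obtain T where fin: "\<And>c. finite (T c)"
    and T: "\<And>c D. finite D \<Longrightarrow> T c \<subseteq> D \<Longrightarrow> \<exists>v\<in>T c. c v \<noteq> f D v"
    by metis
  define X where "X = product_topology (\<lambda>_::'a. discrete_topology (UNIV::bool set)) UNIV"
  define B where "B c = PiE UNIV (\<lambda>i. if i \<in> T c then {c i} else UNIV)" for c
  have "compact_space X"
    unfolding X_def by (simp add: compact_space_product_topology compact_space_discrete_topology)
  moreover have top: "topspace X = UNIV"
    unfolding X_def by simp
  moreover have "openin X (B c)" for c
  proof -
    have "{i. (if i \<in> T c then {c i} else UNIV) \<noteq> UNIV} \<subseteq> T c"
      by auto
    then show ?thesis
      unfolding X_def B_def openin_PiE_gen using fin[of c] by (auto intro: finite_subset)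
  qed
  moreover have in_B: "d \<in> B c \<longleftrightarrow> (\<forall>i\<in>T c. d i = c i)" for c d
    unfolding B_def by (auto simp: PiE_iff)
  then have "\<Union>(range B) = UNIV"
    by blast
  ultimately obtain \<F> where "finite \<F>" "\<F> \<subseteq> range B" "\<Union>\<F> = UNIV"
    unfolding compact_space by (metis (no_types, lifting) imageE)
  then obtain C where C: "finite C" "(\<Union>c\<in>C. B c) = UNIV"
    by (metis finite_subset_image)
  \<comment> \<open>\<open>D\<close> contains the support of every cylinder in the finite cover, so
    whichever \<open>B c\<close> contains \<open>f D\<close>, the choice of \<open>T c\<close> is
    violated.\<close>
  define D where "D = (\<Union>c\<in>C. T c)"
  obtain c where c: "c \<in> C" "f D \<in> B c"
    using C(2) by (metis UNIV_I UN_E)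
  then have "finite D" "T c \<subseteq> D"
    using C(1) fin by (auto simp: D_def)
  then obtain v where "v \<in> T c" "c v \<noteq> f D v"
    using T by metis
  then show False
    using c(2) in_B by metis
qed

section \<open>Cardinal arithmetic\<close>

lemma card_of_Un_ordLeq:
  assumes "infinite C" "|A| \<le>o |C|" "|B| \<le>o |C|"
  shows "|A \<union> B| \<le>o |C|"
  using assms by (intro card_of_Un_ordLeq_infinite_Field card_of_Card_order) (simp_all add: Field_card_of)

lemma card_of_finite_ordLess:
  assumes "finite A" "infinite B"
  shows "|A| <o |B|"
  using assms by (intro finite_ordLess_infinite card_of_Well_order) (simp_all add: Field_card_of)

lemma card_of_not_ordLeq: "\<not> |A| \<le>o |B| \<longleftrightarrow> |B| <o |A|"
  by (rule not_ordLeq_iff_ordLess[OF card_of_Well_order card_of_Well_order])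

lemma card_of_subset_ordLeq: "A \<subseteq> B \<Longrightarrow> |B| \<le>o r \<Longrightarrow> |A| \<le>o r"
  by (rule ordLeq_transitive[OF card_of_mono1])

section \<open>Assembling a ray from finite paths\<close>

lemma ray_of_segments:
  assumes ne: "\<And>n. A n \<noteq> []" and inV: "\<And>n. set (A n) \<subseteq> V"
    and dist: "\<And>n. distinct (A n)" and disj: "\<And>m n. m < n \<Longrightarrow> set (A m) \<inter> set (A n) = {}"
    and suc: "\<And>n. successively (\<lambda>u v. {u, v} \<in> E) (A n)"
    and link: "\<And>n. {last (A n), hd (A (Suc n))} \<in> E"
  shows "\<exists>r. is_ray V E r \<and> range r = (\<Union>n. set (A n))"
proof -
  define L where "L n = concat (map A [0..<n])" for n
  have L_Suc: "L (Suc n) = L n @ A n" for n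
    by (simp add: L_def)
  have set_L: "set (L n) = (\<Union>i<n. set (A i))" for n
    by (auto simp: L_def)
  have dist_L: "distinct (L n)" for n
  proof (induction n)
    case (Suc n)
    then show ?case
      using dist[of n] disj[of _ n] by (auto simp: L_Suc set_L)
  qed (simp add: L_def)
  have last_L: "L (Suc n) \<noteq> [] \<and> last (L (Suc n)) = last (A n)" for n
    using ne[of n] by (simp add: L_Suc)
  have suc_L: "successively (\<lambda>u v. {u, v} \<in> E) (L n)" for n
  proof (induction n)
    case (Suc n)
    show ?case
    proof (cases n)
      case 0
      then show ?thesis
        using suc[of 0] by (simp add: L_def)
    next
      case (Suc m)
      then show ?thesis
        using Suc.IH suc[of n] last_L[of m] link[of m]
        unfolding L_Suc[of n] by (simp add: successively_append_iff)
    qed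
  qed (simp add: L_def)
  have len: "n \<le> length (L n)" for n
  proof (induction n)
    case (Suc n)
    then show ?case
      using ne[of n] by (cases "A n") (auto simp: L_Suc)
  qed simp
  have stable: "L (m + k) ! i = L m ! i \<and> i < length (L (m + k))" if "i < length (L m)" for m k i
    using that by (induction k) (auto simp: L_Suc nth_append)
  \<comment> \<open>No segment is empty, so \<open>L (Suc i)\<close> does have an entry
    \<open>i\<close>; longer concatenations only extend it.\<close>
  define r where "r i = L (Suc i) ! i" for i
  have r: "r i = L n ! i" if "i < length (L n)" for i n
  proof (cases "Suc i \<le> n")
    case True
    then show ?thesis
      using stable[of i "Suc i" "n - Suc i"] len[of "Suc i"] by (simp add: r_def)
  next
    case False
    then show ?thesis
      using stable[of i n "Suc i - n"] that by (simp add: r_def)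
  qed
  have range: "range r = (\<Union>n. set (A n))"
  proof
    show "range r \<subseteq> (\<Union>n. set (A n))"
    proof clarify
      fix i
      have "r i \<in> set (L (Suc i))"
        unfolding r_def using len[of "Suc i"] by (intro nth_mem) simp
      then show "r i \<in> (\<Union>n. set (A n))"
        by (auto simp: set_L)
    qed
    show "(\<Union>n. set (A n)) \<subseteq> range r"
    proof clarify
      fix x n
      assume "x \<in> set (A n)"
      then have "x \<in> set (L (Suc n))"
        by (auto simp: set_L)
      then obtain i where "i < length (L (Suc n))" "L (Suc n) ! i = x"
        by (metis in_set_conv_nth)
      then show "x \<in> range r"
        using r by (metis rangeI)
    qed
  qed
  have "inj r"
  proof (rule injI)
    fix i j
    assume eq: "r i = r j"
    let ?n = "Suc (max i j)"
    have "i < length (L ?n)" "j < length (L ?n)"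
      using len[of ?n] by auto
    then show "i = j"
      using eq r dist_L[of ?n] by (metis nth_eq_iff_index_eq)
  qed
  moreover have "{r n, r (Suc n)} \<in> E" for n
  proof -
    let ?k = "Suc (Suc n)"
    have "Suc n < length (L ?k)"
      using len[of ?k] by simp
    then show ?thesis
      using suc_L[of ?k] r[of n ?k] r[of "Suc n" ?k] by (simp add: successively_conv_nth)
  qed
  moreover have "range r \<subseteq> V"
    using range inV by auto
  ultimately show ?thesis
    using range unfolding is_ray_def by blast
qed

section \<open>Counting monochromatic edges\<close>

locale sgraph =
  fixes V :: "'a set" and E :: "'a set set"
  assumes simple: "simple_graph V E"
begin

abbreviation N :: "'a \<Rightarrow> 'a set" where
  "N \<equiv> neighbours E"

definition InfDeg :: "'a set" where
  "InfDeg = {v. infinite_degree E v}"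

lemma finite_N: "v \<notin> InfDeg \<Longrightarrow> finite (N v)"
  and infinite_N: "v \<in> InfDeg \<Longrightarrow> infinite (N v)"
  by (auto simp: InfDeg_def infinite_degree_def)

lemma N_sym: "y \<in> N x \<longleftrightarrow> x \<in> N y"
  by (simp add: neighbours_def insert_commute)

lemma N_irrefl: "x \<notin> N x"
  using simple by (auto simp: neighbours_def simple_graph_def doubleton_eq_iff)

definition inc :: "'a set \<Rightarrow> 'a set set" where
  "inc D = {e \<in> E. e \<inter> D \<noteq> {}}"

lemma incE:
  assumes "e \<in> inc D"
  obtains x y where "x \<in> D" "y \<in> N x" "x \<noteq> y" "e = {x, y}"
proof -
  have "e \<in> E" and ne: "e \<inter> D \<noteq> {}"
    using assms by (auto simp: inc_def)
  then obtain u v where uv: "e = {u, v}" "u \<noteq> v" "{u, v} \<in> E"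
    using simple unfolding simple_graph_def by blast
  then have "{v, u} \<in> E"
    by (simp add: insert_commute)
  then show thesis
    using that[of u v] that[of v u] uv ne by (auto simp: neighbours_def)
qed

lemma inc_eq: "inc D = (\<Union>x\<in>D. (\<lambda>y. {x, y}) ` N x)"
proof
  show "inc D \<subseteq> (\<Union>x\<in>D. (\<lambda>y. {x, y}) ` N x)"
    by (blast elim: incE)
qed (auto simp: inc_def neighbours_def)

lemma finite_inc: "finite D \<Longrightarrow> D \<inter> InfDeg = {} \<Longrightarrow> finite (inc D)"
  unfolding inc_eq using finite_N by blast

lemma inc_mono: "D \<subseteq> D' \<Longrightarrow> inc D \<subseteq> inc D'"
  by (auto simp: inc_def)

definition mono_edge :: "('a \<Rightarrow> bool) \<Rightarrow> 'a set \<Rightarrow> bool" where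
  "mono_edge c e \<longleftrightarrow> (\<forall>x\<in>e. \<forall>y\<in>e. c x = c y)"

text \<open>Integer-valued because \<open>gain\<close> is a difference of such counts and may be
  negative.\<close>

definition num_mono :: "('a \<Rightarrow> bool) \<Rightarrow> 'a set set \<Rightarrow> int" where
  "num_mono c M = int (card {e \<in> M. mono_edge c e})"

lemma num_mono_cong:
  assumes "\<And>e x. e \<in> M \<Longrightarrow> x \<in> e \<Longrightarrow> c x = d x"
  shows "num_mono c M = num_mono d M"
proof -
  have "mono_edge c e = mono_edge d e" if "e \<in> M" for e
    using assms[OF that] unfolding mono_edge_def by metis
  then have "{e \<in> M. mono_edge c e} = {e \<in> M. mono_edge d e}"
    by blast
  then show ?thesis
    by (simp add: num_mono_def)
qed

lemma num_mono_split:
  assumes "finite M" "K \<subseteq> M"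
  shows "num_mono c M = num_mono c K + num_mono c (M - K)"
proof -
  have "{e \<in> M. mono_edge c e} = {e \<in> K. mono_edge c e} \<union> {e \<in> M - K. mono_edge c e}"
    using assms by auto
  moreover have "card ({e \<in> K. mono_edge c e} \<union> {e \<in> M - K. mono_edge c e})
      = card {e \<in> K. mono_edge c e} + card {e \<in> M - K. mono_edge c e}"
    using assms by (intro card_Un_disjoint) (auto intro: finite_subset)
  ultimately show ?thesis
    by (simp add: num_mono_def)
qed

lemma num_mono_le_card: "finite M \<Longrightarrow> num_mono c M \<le> int (card M)"
  by (simp add: num_mono_def card_mono)

lemma num_mono_nonneg: "0 \<le> num_mono c M"
  by (simp add: num_mono_def)

definition agree_off :: "'a set \<Rightarrow> ('a \<Rightarrow> bool) \<Rightarrow> ('a \<Rightarrow> bool) \<Rightarrow> bool" where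
  "agree_off D c c' \<longleftrightarrow> (\<forall>v. v \<notin> D \<longrightarrow> c' v = c v)"

text \<open>All edges at \<open>D\<close> are counted, so this is meaningful only if \<open>D\<close> is finite and consists of vertices
  of finite degree; otherwise \<open>card\<close> may be \<open>0\<close> on an infinite set of edges.\<close>

definition gain :: "'a set \<Rightarrow> ('a \<Rightarrow> bool) \<Rightarrow> ('a \<Rightarrow> bool) \<Rightarrow> int" where
  "gain D c c' = num_mono c (inc D) - num_mono c' (inc D)"

text \<open>Edges that meet \<open>D'\<close> but not \<open>D\<close> have both ends outside
  \<open>D\<close>, so the change does not affect them. Finiteness of \<open>inc D'\<close> makes
  the counts additive.\<close>

lemma gain_superset:
  assumes "finite D'" "D' \<inter> InfDeg = {}" "D \<subseteq> D'" "agree_off D c c'"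
  shows "gain D' c c' = gain D c c'"
proof -
  have "num_mono c (inc D' - inc D) = num_mono c' (inc D' - inc D)"
    using assms(4) by (intro num_mono_cong) (auto simp: inc_def agree_off_def)
  then show ?thesis
    using num_mono_split[OF finite_inc[OF assms(1,2)] inc_mono[OF assms(3)]] by (simp add: gain_def)
qed

lemma gain_cong:
  assumes "\<And>x y. x \<in> D \<Longrightarrow> y \<in> insert x (N x) \<Longrightarrow> c y = d y \<and> c' y = d' y"
  shows "gain D c c' = gain D d d'"
proof -
  have "num_mono c (inc D) = num_mono d (inc D)"
    using assms by (intro num_mono_cong) (auto elim!: incE)
  moreover have "num_mono c' (inc D) = num_mono d' (inc D)"
    using assms by (intro num_mono_cong) (auto elim!: incE)
  ultimately show ?thesis
    by (simp add: gain_def)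
qed

section \<open>Optimal colourings\<close>

definition opt :: "'a set \<Rightarrow> ('a \<Rightarrow> bool) \<Rightarrow> bool" where
  "opt W c \<longleftrightarrow> (\<forall>D c'. finite D \<and> D \<subseteq> W - InfDeg \<and> agree_off D c c' \<longrightarrow> gain D c c' \<le> 0)"

lemma optD: "opt W c \<Longrightarrow> finite D \<Longrightarrow> D \<subseteq> W - InfDeg \<Longrightarrow> agree_off D c c' \<Longrightarrow> gain D c c' \<le> 0"
  by (auto simp: opt_def)

lemma opt_cong:
  assumes "opt W c" and "\<And>x y. x \<in> W - InfDeg \<Longrightarrow> y \<in> insert x (N x) \<Longrightarrow> c y = d y"
  shows "opt W d"
  unfolding opt_def
proof clarify
  fix D d'
  assume D: "finite D" "D \<subseteq> W - InfDeg" "agree_off D d d'"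
  let ?c = "\<lambda>x. if x \<in> D then d' x else c x"
  have "gain D c ?c \<le> 0"
    using assms(1) D by (intro optD) (auto simp: agree_off_def)
  moreover have "gain D c ?c = gain D d d'"
  proof (rule gain_cong)
    fix x y
    assume "x \<in> D" "y \<in> insert x (N x)"
    then have "c y = d y"
      using assms(2) D(2) by blast
    then show "c y = d y \<and> ?c y = d' y"
      using D(3) by (auto simp: agree_off_def)
  qed
  ultimately show "gain D d d' \<le> 0"
    by simp
qed

text \<open>Adjacent vertices of finite degree in \<open>U\<close> lie in the same class of
  \<open>k\<close>, so changes in different classes do not interact and their gains add up. The
  induction on \<open>D\<close> peels off one class at a time.\<close>

lemma opt_glue:
  assumes k: "\<And>x y. x \<in> U - InfDeg \<Longrightarrow> y \<in> U - InfDeg \<Longrightarrow> y \<in> N x \<Longrightarrow> k x = k y"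
    and parts: "\<And>i. opt {x \<in> U. k x = i} c"
  shows "opt U c"
proof -
  have "\<forall>c'. D \<subseteq> U - InfDeg \<longrightarrow> agree_off D c c' \<longrightarrow> gain D c c' \<le> 0" if "finite D" for D
    using that
  proof (induction D rule: finite_psubset_induct)
    case (psubset D)
    show ?case
    proof (intro allI impI)
      fix c'
      assume D: "D \<subseteq> U - InfDeg" and off: "agree_off D c c'"
      show "gain D c c' \<le> 0"
      proof (cases "D = {}")
        case True
        then show ?thesis
          by (simp add: gain_def inc_def num_mono_def)
      next
        case False
        then obtain v where v: "v \<in> D"
          by blast
        \<comment> \<open>The change from \<open>c\<close> to \<open>c'\<close> is made in two
          stages: first on the class of \<open>v\<close>, giving \<open>c1\<close>, then on the
          rest. \<open>c2\<close> makes the second stage directly from \<open>c\<close>.\<close>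
        define D1 D2 where "D1 = {x \<in> D. k x = k v}" and "D2 = D - D1"
        define c1 c2 where "c1 = (\<lambda>x. if x \<in> D1 then c' x else c x)"
          and "c2 = (\<lambda>x. if x \<in> D2 then c' x else c x)"
        have DX: "D \<inter> InfDeg = {}" and sub: "D1 \<subseteq> D" "D2 \<subseteq> D" "D2 \<subset> D"
          using D v by (auto simp: D1_def D2_def)
        have off1: "agree_off D1 c c1" "agree_off D2 c1 c'" "agree_off D2 c c2"
          using off by (auto simp: agree_off_def c1_def c2_def D2_def)
        have "gain D c c' = gain D c c1 + gain D c1 c'"
          by (simp add: gain_def)
        also have "gain D c c1 = gain D1 c c1"
          using psubset.hyps DX sub off1 by (intro gain_superset) auto
        also have "gain D c1 c' = gain D2 c1 c'"
          using psubset.hyps DX sub off1 by (intro gain_superset) auto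
        \<comment> \<open>No vertex of \<open>D2\<close> has a neighbour in \<open>D1\<close>, so
          the second stage gains the same whether or not the first was made.\<close>
        also have "gain D2 c1 c' = gain D2 c c2"
        proof (rule gain_cong)
          fix x y
          assume x: "x \<in> D2" and y: "y \<in> insert x (N x)"
          have "y \<notin> D1"
          proof
            assume "y \<in> D1"
            moreover have "y \<noteq> x"
              using x \<open>y \<in> D1\<close> by (auto simp: D2_def)
            ultimately have "k x = k y"
              using k[of x y] x y D sub by auto
            then show False
              using x \<open>y \<in> D1\<close> by (auto simp: D1_def D2_def)
          qed
          then show "c1 y = c y \<and> c' y = c2 y"
            using off by (auto simp: c1_def c2_def D2_def agree_off_def)
        qed
        also have "gain D1 c c1 + gain D2 c c2 \<le> 0 + 0"
        proof (rule add_mono)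
          show "gain D1 c c1 \<le> 0"
            using D psubset.hyps off1 by (intro optD[OF parts[of "k v"]]) (auto simp: D1_def)
          show "gain D2 c c2 \<le> 0"
            using psubset.IH[OF sub(3)] sub D off1 by auto
        qed
        finally show ?thesis
          by simp
      qed
    qed
  qed
  then show ?thesis
    by (auto simp: opt_def)
qed

section \<open>Flipping one vertex\<close>

abbreviation flip :: "'a \<Rightarrow> ('a \<Rightarrow> bool) \<Rightarrow> 'a \<Rightarrow> bool" where
  "flip s c \<equiv> c(s := \<not> c s)"

lemma num_mono_flip:
  assumes "finite K" "\<And>e. e \<in> K \<Longrightarrow> e \<in> E \<and> s \<in> e"
  shows "num_mono (flip s c) K = int (card K) - num_mono c K"
proof -
  have "mono_edge (flip s c) e \<longleftrightarrow> \<not> mono_edge c e" if "e \<in> K" for e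
  proof -
    have "e \<in> inc {s}"
      using assms(2)[OF that] by (auto simp: inc_def)
    then obtain y where "e = {s, y}" "s \<noteq> y"
      by (auto elim: incE)
    then show ?thesis
      by (auto simp: mono_edge_def)
  qed
  then have "{e \<in> K. mono_edge (flip s c) e} = K - {e \<in> K. mono_edge c e}"
    by auto
  then show ?thesis
    using assms(1) by (simp add: num_mono_def card_Diff_subset card_mono of_nat_diff)
qed

text \<open>Only the set \<open>K\<close> of edges between \<open>s\<close> and \<open>D\<close>
  matters: the flip toggles them and thereby reverses the sign of their contribution to the gain.
  The gain grows by twice the increase of monochromatic edges in \<open>K\<close> from
  \<open>c\<close> to \<open>c'\<close>, hence by at most twice the number of edges in
  \<open>K\<close> not monochromatic in \<open>c\<close>.\<close>

lemma gain_flip: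
  assumes D: "finite D" "D \<inter> InfDeg = {}" "s \<notin> D"
  shows "gain D (flip s c) (flip s c') \<le> gain D c c' + 2 * int (card {y \<in> D. y \<in> N s \<and> c y \<noteq> c s})"
proof -
  define K where "K = {e \<in> inc D. s \<in> e}"
  have fin: "finite (inc D)" "finite K" and K: "K \<subseteq> inc D"
    using finite_inc[OF D(1,2)] by (auto simp: K_def)
  have rest: "num_mono (flip s d) (inc D - K) = num_mono d (inc D - K)" for d
    by (rule num_mono_cong) (auto simp: K_def)
  have onK: "num_mono (flip s d) K = int (card K) - num_mono d K" for d
    using fin by (intro num_mono_flip) (auto simp: K_def inc_def)
  have "{e \<in> K. \<not> mono_edge c e} \<subseteq> (\<lambda>y. {s, y}) ` {y \<in> D. y \<in> N s \<and> c y \<noteq> c s}"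
  proof clarify
    fix e
    assume e: "e \<in> K" "\<not> mono_edge c e"
    then obtain x y where xy: "x \<in> D" "y \<in> N x" "e = {x, y}"
      by (auto simp: K_def elim: incE)
    then have "y = s"
      using e D by (auto simp: K_def)
    then show "e \<in> (\<lambda>y. {s, y}) ` {y \<in> D. y \<in> N s \<and> c y \<noteq> c s}"
      using xy e(2) N_sym by (intro image_eqI[of _ _ x]) (auto simp: mono_edge_def)
  qed
  then have "card {e \<in> K. \<not> mono_edge c e} \<le> card {y \<in> D. y \<in> N s \<and> c y \<noteq> c s}"
    using D(1) by (intro surj_card_le) auto
  moreover have "int (card K) - num_mono c K = int (card {e \<in> K. \<not> mono_edge c e})"
  proof -
    have "{e \<in> K. \<not> mono_edge c e} = K - {e \<in> K. mono_edge c e}"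
      by auto
    then show ?thesis
      using fin by (simp add: num_mono_def card_Diff_subset card_mono of_nat_diff)
  qed
  ultimately show ?thesis
    using num_mono_split[OF fin(1) K] rest onK num_mono_le_card[OF fin(2), of c'] by (simp add: gain_def)
qed

section \<open>Happiness\<close>

text \<open>This is \<open>happy\<close> for colourings with values in \<open>bool\<close>, where a
  flip is a negation.\<close>

definition hap :: "('a \<Rightarrow> bool) \<Rightarrow> 'a \<Rightarrow> bool" where
  "hap c x \<longleftrightarrow> |{y \<in> N x. c y = c x}| \<le>o |{y \<in> N x. c y \<noteq> c x}|"

lemma hap_mono:
  assumes "hap c x" "{y \<in> N x. d y = d x} \<subseteq> {y \<in> N x. c y = c x}"
  shows "hap d x"
proof -
  have "{y \<in> N x. c y \<noteq> c x} \<subseteq> {y \<in> N x. d y \<noteq> d x}"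
    using assms(2) by auto
  then show ?thesis
    using assms unfolding hap_def by (meson card_of_mono1 ordLeq_transitive)
qed

lemma hap_cong: "hap c x \<Longrightarrow> (\<And>y. y \<in> insert x (N x) \<Longrightarrow> c y = d y) \<Longrightarrow> hap d x"
  by (erule hap_mono) auto

text \<open>The infinite set \<open>N x\<close> is the union of friends and opponents, so if the
  opponents are at least as many as the friends, they already have the full cardinality of
  \<open>N x\<close>.\<close>

lemma hap_infinite_iff:
  assumes "x \<in> InfDeg"
  shows "hap c x \<longleftrightarrow> |N x| \<le>o |{y \<in> N x. c y \<noteq> c x}|"
proof
  let ?F = "{y \<in> N x. c y = c x}" and ?O = "{y \<in> N x. c y \<noteq> c x}"
  have N: "N x = ?F \<union> ?O"
    by auto
  assume h: "hap c x"
  have "infinite ?O"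
  proof
    assume "finite ?O"
    moreover from this have "finite ?F"
      using h unfolding hap_def by (rule card_of_ordLeq_finite[rotated])
    ultimately have "finite (?F \<union> ?O)"
      by simp
    then have "finite (N x)"
      by (rule back_subst[OF _ N[symmetric]])
    then show False
      using infinite_N[OF assms] by simp
  qed
  then have "|?F \<union> ?O| \<le>o |?O|"
    using h unfolding hap_def by (intro card_of_Un_ordLeq) (assumption | rule card_of_mono1 subset_refl)+
  then show "|N x| \<le>o |?O|"
    by (rule back_subst[OF _ N[symmetric], of "\<lambda>A. |A| \<le>o |?O|"])
next
  have "|{y \<in> N x. c y = c x}| \<le>o |N x|"
    by (rule card_of_mono1) auto
  moreover assume "|N x| \<le>o |{y \<in> N x. c y \<noteq> c x}|"
  ultimately show "hap c x"
    unfolding hap_def by (rule ordLeq_transitive)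
qed

lemma not_hap_infinite_iff:
  assumes "x \<in> InfDeg"
  shows "\<not> hap c x \<longleftrightarrow> |{y \<in> N x. c y \<noteq> c x}| <o |N x|"
  using hap_infinite_iff[OF assms] card_of_not_ordLeq by blast

text \<open>Otherwise the opponents in \<open>c\<close> would be covered by the opponents in
  \<open>d\<close> and the changed vertices, two sets smaller than the infinite set
  \<open>N x\<close>.\<close>

lemma hap_few_changes:
  assumes x: "x \<in> InfDeg" and h: "hap c x" and "d x = c x" and few: "|{y. d y \<noteq> c y}| <o |N x|"
  shows "hap d x"
proof (rule ccontr)
  assume "\<not> hap d x"
  then have "|{y \<in> N x. d y \<noteq> d x} \<union> {y. d y \<noteq> c y}| <o |N x|"
    using x few infinite_N by (intro card_of_Un_ordLess_infinite) (auto simp: not_hap_infinite_iff)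
  moreover have "{y \<in> N x. c y \<noteq> c x} \<subseteq> {y \<in> N x. d y \<noteq> d x} \<union> {y. d y \<noteq> c y}"
    using assms(3) by auto
  ultimately have "|{y \<in> N x. c y \<noteq> c x}| <o |N x|"
    by (meson card_of_mono1 ordLeq_ordLess_trans)
  then show False
    using x h not_hap_infinite_iff by blast
qed

text \<open>If \<open>x\<close> were unhappy in both colours, \<open>N x\<close> would be covered by
  three smaller sets: an unchanged neighbour is an opponent of \<open>x\<close> in \<open>c\<close>
  or in \<open>d\<close>.\<close>

lemma hap_flipped_few_changes:
  assumes x: "x \<in> InfDeg" and h: "\<not> hap c x" and "d x \<noteq> c x" and few: "|{y. d y \<noteq> c y}| <o |N x|"
  shows "hap d x"
proof (rule ccontr)
  assume "\<not> hap d x"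
  then have "|{y \<in> N x. d y \<noteq> d x} \<union> {y \<in> N x. c y \<noteq> c x} \<union> {y. d y \<noteq> c y}| <o |N x|"
    using x few h infinite_N by (intro card_of_Un_ordLess_infinite) (auto simp: not_hap_infinite_iff)
  moreover have "N x \<subseteq> {y \<in> N x. d y \<noteq> d x} \<union> {y \<in> N x. c y \<noteq> c x} \<union> {y. d y \<noteq> c y}"
    using assms(3) by auto
  ultimately have "|N x| <o |N x|"
    by (meson card_of_mono1 ordLeq_ordLess_trans)
  then show False
    using ordLess_irreflexive by blast
qed

lemma finite_ordLess_N: "x \<in> InfDeg \<Longrightarrow> finite A \<Longrightarrow> |A| <o |N x|"
  using infinite_N by (intro card_of_finite_ordLess)

text \<open>Optimality is applied to the flip of \<open>x\<close> alone, which exchanges friends and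
  opponents.\<close>

lemma hap_if_opt:
  assumes "opt W c" "x \<in> W - InfDeg"
  shows "hap c x"
proof -
  have fin: "finite (N x)"
    using assms(2) finite_N by auto
  have inj: "inj_on (\<lambda>y. {x, y}) (N x)"
    by (auto simp: inj_on_def doubleton_eq_iff)
  have num: "num_mono d (inc {x}) = int (card {y \<in> N x. d y = d x})" for d
  proof -
    have "{e \<in> inc {x}. mono_edge d e} = (\<lambda>y. {x, y}) ` {y \<in> N x. d y = d x}"
      by (auto simp: inc_eq mono_edge_def)
    moreover have "inj_on (\<lambda>y. {x, y}) {y \<in> N x. d y = d x}"
      using inj by (rule inj_on_subset) auto
    ultimately show ?thesis
      by (simp add: num_mono_def card_image)
  qed
  have "gain {x} c (flip x c) \<le> 0"
    using assms by (intro optD) (auto simp: agree_off_def)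
  moreover have "{y \<in> N x. (flip x c) y = (flip x c) x} = {y \<in> N x. c y \<noteq> c x}"
    using N_irrefl by auto
  ultimately have "card {y \<in> N x. c y = c x} \<le> card {y \<in> N x. c y \<noteq> c x}"
    unfolding gain_def num by simp
  then show ?thesis
    unfolding hap_def card_of_ordLeq[symmetric] using fin by (subst inj_on_iff_card_le) auto
qed

text \<open>Gains are bounded integers, so some finite change of \<open>c\<close> has the greatest
  gain; any further improvement would combine with it to a better finite change.\<close>

lemma finite_repair:
  assumes bdd: "\<And>D d. finite D \<Longrightarrow> D \<subseteq> W - InfDeg \<Longrightarrow> agree_off D c d \<Longrightarrow> gain D c d \<le> B"
  shows "\<exists>D d. finite D \<and> D \<subseteq> W - InfDeg \<and> agree_off D c d \<and> opt W d"
proof -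
  define ok where "ok p \<longleftrightarrow> finite (fst p) \<and> fst p \<subseteq> W - InfDeg \<and> agree_off (fst p) c (snd p)" for p
  \<comment> \<open>The bound \<open>B\<close> ensures that \<open>nat\<close> truncates nothing on
    pairs satisfying \<open>ok\<close>.\<close>
  define m where "m p = nat (B - gain (fst p) c (snd p))" for p
  have "ok ({}, c)"
    by (simp add: ok_def agree_off_def)
  then obtain p where p: "ok p" and min: "\<And>q. ok q \<Longrightarrow> m p \<le> m q"
    using ex_has_least_nat[of ok _ m] by blast
  obtain D d where [simp]: "p = (D, d)"
    by (cases p)
  have D: "finite D" "D \<subseteq> W - InfDeg" "agree_off D c d"
    using p by (auto simp: ok_def)
  have "opt W d"
    unfolding opt_def
  proof clarify
    fix D2 d'
    assume D2: "finite D2" "D2 \<subseteq> W - InfDeg" "agree_off D2 d d'"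
    let ?D = "D \<union> D2"
    have "ok (?D, d')"
      using D D2 by (auto simp: ok_def agree_off_def)
    then have "gain ?D c d' \<le> gain D c d"
      using min[of "(?D, d')"] bdd[of ?D d'] bdd[OF D] by (auto simp: ok_def m_def)
    also have "gain D c d = gain ?D c d"
      using D D2 by (intro gain_superset[symmetric]) auto
    finally have "gain ?D d d' \<le> 0"
      by (simp add: gain_def)
    moreover have "gain ?D d d' = gain D2 d d'"
      using D D2 by (intro gain_superset) auto
    ultimately show "gain D2 d d' \<le> 0"
      by simp
  qed
  then show ?thesis
    using D by blast
qed

section \<open>Solvable sets\<close>

definition solvable :: "'a set \<Rightarrow> bool" where
  "solvable U \<longleftrightarrow> (\<forall>c0. \<exists>c. agree_off U c0 c \<and> (\<forall>x\<in>U. hap c x) \<and> opt U c)"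

text \<open>The hereditary form is needed because adding a vertex of infinite degree calls for a new
  solution on a subset that is only determined by the old one.\<close>

definition hsolvable :: "'a set \<Rightarrow> bool" where
  "hsolvable W \<longleftrightarrow> (\<forall>U\<subseteq>W. solvable U)"

text \<open>Happiness of a vertex of infinite degree is immune to finitely many changes.\<close>

lemma repair_solution:
  assumes bdd: "\<And>D d. finite D \<Longrightarrow> D \<subseteq> U - InfDeg \<Longrightarrow> agree_off D c d \<Longrightarrow> gain D c d \<le> B"
    and hap: "\<And>x. x \<in> U \<inter> InfDeg \<Longrightarrow> hap c x" and off: "agree_off U c0 c"
  shows "\<exists>c. agree_off U c0 c \<and> (\<forall>x\<in>U. hap c x) \<and> opt U c"
proof -
  obtain D d where D: "finite D" "D \<subseteq> U - InfDeg" "agree_off D c d" and opt: "opt U d"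
    using finite_repair[of U c B] bdd by (metis (no_types, lifting))
  have "hap d x" if x: "x \<in> U" for x
  proof (cases "x \<in> InfDeg")
    case True
    have "{y. d y \<noteq> c y} \<subseteq> D"
      using D(3) by (auto simp: agree_off_def)
    then have "|{y. d y \<noteq> c y}| <o |N x|"
      using D(1) True by (intro finite_ordLess_N) (auto intro: finite_subset)
    moreover have "d x = c x"
      using D True by (auto simp: agree_off_def)
    ultimately show ?thesis
      using hap_few_changes True hap x by blast
  qed (use hap_if_opt opt x in auto)
  moreover have "agree_off U c0 d"
    using D off by (auto simp: agree_off_def)
  ultimately show ?thesis
    using opt by blast
qed

text \<open>\<open>f D\<close> minimises the number of monochromatic edges at
  \<open>D \<inter> U\<close>. Gains of finite changes depend on finitely many colours only, so a
  limit of the \<open>f D\<close> given by compactness inherits optimality.\<close>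

lemma solvable_locally_finite:
  assumes "U \<inter> InfDeg = {}"
  shows "solvable U"
  unfolding solvable_def
proof
  fix c0
  have "\<exists>d. agree_off (D \<inter> U) c0 d \<and> (\<forall>d'. agree_off (D \<inter> U) c0 d' \<longrightarrow> 0 \<ge> gain (D \<inter> U) d d')" for D
  proof -
    have "\<exists>d. agree_off (D \<inter> U) c0 d \<and>
       (\<forall>d'. agree_off (D \<inter> U) c0 d' \<longrightarrow> nat (num_mono d (inc (D \<inter> U))) \<le> nat (num_mono d' (inc (D \<inter> U))))"
      by (rule ex_has_least_nat[of _ c0]) (simp add: agree_off_def)
    then show ?thesis
      unfolding gain_def using num_mono_nonneg by (simp add: nat_le_eq_zle)
  qed
  then obtain f where f_off: "\<And>D. agree_off (D \<inter> U) c0 (f D)"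
    and f_min: "\<And>D d'. agree_off (D \<inter> U) c0 d' \<Longrightarrow> gain (D \<inter> U) (f D) d' \<le> 0"
    by metis
  obtain c where c: "\<And>T. finite T \<Longrightarrow> \<exists>D. finite D \<and> T \<subseteq> D \<and> (\<forall>v\<in>T. c v = f D v)"
    using selection_compactness[of f] by blast
  have off: "agree_off U c0 c"
    unfolding agree_off_def
  proof (intro allI impI)
    fix v
    assume "v \<notin> U"
    moreover obtain D where "c v = f D v"
      using c[of "{v}"] by auto
    ultimately show "c v = c0 v"
      using f_off[of D] by (auto simp: agree_off_def)
  qed
  have "opt U c"
    unfolding opt_def
  proof clarify
    fix D c'
    assume D: "finite D" "D \<subseteq> U - InfDeg" "agree_off D c c'"
    \<comment> \<open>\<open>?T\<close> carries all colours on which a gain at \<open>D\<close>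
      depends.\<close>
    let ?T = "D \<union> (\<Union>x\<in>D. N x)"
    have "finite ?T"
      using D finite_N by auto
    then obtain D' where D': "finite D'" "?T \<subseteq> D'" "\<And>v. v \<in> ?T \<Longrightarrow> c v = f D' v"
      using c by meson
    let ?d = "\<lambda>x. if x \<in> D then c' x else f D' x"
    have "gain D c c' = gain D (f D') ?d"
      using D' D(3) by (intro gain_cong) (auto simp: agree_off_def)
    also have "\<dots> = gain (D' \<inter> U) (f D') ?d"
      using D D' assms by (intro gain_superset[symmetric]) (auto simp: agree_off_def)
    also have "\<dots> \<le> 0"
      using f_off[of D'] D D' by (intro f_min) (auto simp: agree_off_def)
    finally show "gain D c c' \<le> 0" .
  qed
  then show "\<exists>c. agree_off U c0 c \<and> (\<forall>x\<in>U. hap c x) \<and> opt U c"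
    using off hap_if_opt assms by blast
qed

text \<open>The step to neighbours inside \<open>L\<close> is iterated countably often from
  \<open>F0\<close>. Each vertex of \<open>L\<close> has at most \<open>|F|\<close> neighbours and
  \<open>F\<close> is infinite, so all stages and their union have size at most
  \<open>|F|\<close>.\<close>

lemma closure_exists:
  assumes inf: "infinite F" and F0: "F0 \<subseteq> F" "F0 \<subseteq> L" and L: "\<And>v. v \<in> L \<Longrightarrow> |N v| \<le>o |F|"
  shows "\<exists>U. F0 \<subseteq> U \<and> U \<subseteq> L \<and> |U| \<le>o |F| \<and> (\<forall>u\<in>U. N u \<inter> L \<subseteq> U)"
proof -
  define U where "U n = ((\<lambda>A. \<Union>u\<in>A. N u \<inter> L) ^^ n) F0" for n
  have U_Suc: "U (Suc n) = (\<Union>u\<in>U n. N u \<inter> L)" for n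
    by (simp add: U_def)
  have sub: "U n \<subseteq> L" for n
    using F0 by (cases n) (auto simp: U_Suc, auto simp: U_def)
  have small: "|U n| \<le>o |F|" for n
  proof (induction n)
    case 0
    then show ?case
      using F0(1) by (simp add: U_def card_of_mono1)
  next
    case (Suc n)
    have "|N u \<inter> L| \<le>o |F|" if "u \<in> U n" for u
      using that sub[of n] by (intro card_of_subset_ordLeq[OF _ L]) auto
    then show ?case
      unfolding U_Suc using inf Suc.IH by (intro card_of_UNION_ordLeq_infinite) auto
  qed
  have "|\<Union>n. U n| \<le>o |F|"
    using inf small by (intro card_of_UNION_ordLeq_infinite) (auto simp: infinite_iff_card_of_nat)
  moreover have "F0 \<subseteq> (\<Union>n. U n)"
    by (rule order_trans[OF _ UN_upper[of 0]]) (auto simp: U_def)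
  moreover have "N u \<inter> L \<subseteq> (\<Union>n. U n)" if "u \<in> (\<Union>n. U n)" for u
    using that U_Suc by blast
  ultimately show ?thesis
    using sub by (intro exI[of _ "\<Union>n. U n"]) blast
qed

text \<open>A solution for \<open>U - {s}\<close> need not be optimal on \<open>U\<close>, but
  recolouring \<open>s\<close> can gain no more than the number of edges at \<open>s\<close>. So the
  possible gains are bounded and a finite repair exists.\<close>

lemma solvable_insert_finite_degree:
  assumes "s \<in> U" "s \<notin> InfDeg" and sol: "solvable (U - {s})"
  shows "solvable U"
  unfolding solvable_def
proof
  fix c0
  obtain c where off: "agree_off (U - {s}) c0 c" and hap: "\<And>x. x \<in> U - {s} \<Longrightarrow> hap c x"
    and opt: "opt (U - {s}) c"
    using sol unfolding solvable_def by blast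
  let ?k = "int (card (inc {s}))"
  have bdd: "gain D c d \<le> 2 * ?k" if D: "finite D" "D \<subseteq> U - InfDeg" "agree_off D c d" for D d
  proof -
    \<comment> \<open>\<open>?d\<close> makes the change everywhere except at \<open>s\<close>, so
      optimality on \<open>U - {s}\<close> applies to it.\<close>
    let ?D = "insert s D" and ?d = "d(s := c s)"
    have fin: "finite (inc {s})" "finite (inc ?D)" and DX: "?D \<inter> InfDeg = {}"
      using D assms by (auto intro!: finite_inc)
    have "gain D c d = gain ?D c d"
      using D DX by (intro gain_superset[symmetric]) auto
    also have "\<dots> = gain ?D c ?d + gain ?D ?d d"
      by (simp add: gain_def)
    also have "gain ?D c ?d = gain (D - {s}) c ?d"
      using D DX by (intro gain_superset) (auto simp: agree_off_def)
    also have "gain ?D ?d d = gain {s} ?d d"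
      using D DX by (intro gain_superset) (auto simp: agree_off_def)
    also have "gain (D - {s}) c ?d \<le> 0"
      using D by (intro optD[OF opt]) (auto simp: agree_off_def)
    also have "gain {s} ?d d \<le> ?k"
      using num_mono_le_card[OF fin(1), of ?d] num_mono_nonneg[of d "inc {s}"] by (simp add: gain_def)
    finally show ?thesis
      by simp
  qed
  show "\<exists>c. agree_off U c0 c \<and> (\<forall>x\<in>U. hap c x) \<and> opt U c"
  proof (rule repair_solution[OF bdd])
    show "agree_off U c0 c"
      using off by (auto simp: agree_off_def)
    show "hap c x" if "x \<in> U \<inter> InfDeg" for x
      using that assms hap by blast
  qed
qed

lemma solvable_insert_infinite_degree:
  assumes sU: "s \<in> U" and sX: "s \<in> InfDeg" and sol: "hsolvable (U - {s})"
  shows "solvable U"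
  unfolding solvable_def
proof
  fix c0
  have "solvable (U - {s})"
    using sol by (auto simp: hsolvable_def)
  then obtain c where off: "agree_off (U - {s}) c0 c" and hap: "\<And>x. x \<in> U - {s} \<Longrightarrow> hap c x"
    and opt: "opt (U - {s}) c"
    unfolding solvable_def by blast
  define F where "F = {y \<in> N s. c y \<noteq> c s}"
  have diff1: "{y. flip s c y \<noteq> c y} = {s}"
    by auto
  have gain1: "gain D (flip s c) (flip s d) \<le> 2 * int (card (D \<inter> F))"
    if D: "finite D" "D \<subseteq> U - InfDeg" "agree_off D c d" for D d
  proof -
    have "s \<notin> D" and "D \<inter> InfDeg = {}" and "{y \<in> D. y \<in> N s \<and> c y \<noteq> c s} = D \<inter> F"
      using D sX by (auto simp: F_def)
    moreover have "gain D c d \<le> 0"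
      using D \<open>s \<notin> D\<close> by (intro optD[OF opt]) auto
    ultimately show ?thesis
      using gain_flip[of D s c d] D by simp
  qed
  show "\<exists>c. agree_off U c0 c \<and> (\<forall>x\<in>U. hap c x) \<and> opt U c"
  proof (cases "hap c s")
    case True
    \<comment> \<open>Optimality only tests sets of finite-degree vertices, and \<open>s\<close> is
      in none of them.\<close>
    have "opt U c"
      unfolding opt_def
    proof clarify
      fix D d
      assume "finite D" "D \<subseteq> U - InfDeg" "agree_off D c d"
      then show "gain D c d \<le> 0"
        using sX by (intro optD[OF opt]) auto
    qed
    then show ?thesis
      using True off hap by (intro exI[of _ c]) (auto simp: agree_off_def)
  next
    case False
    then have F_small: "|F| <o |N s|"
      using sX by (simp add: F_def not_hap_infinite_iff)
    show ?thesis
    proof (cases "finite F")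
      case True
      show ?thesis
      proof (rule repair_solution[of _ "flip s c" "2 * int (card F)"])
        fix D d
        assume D: "finite D" "D \<subseteq> U - InfDeg" "agree_off D (flip s c) d"
        have "s \<notin> D"
          using D sX by auto
        \<comment> \<open>Undoing the flip turns \<open>d\<close> into a finite change of
          \<open>c\<close> itself, to which \<open>gain1\<close> applies.\<close>
        then have "flip s (flip s d) = d" "agree_off D c (flip s d)"
          using D by (auto simp: agree_off_def fun_eq_iff)
        then have "gain D (flip s c) d \<le> 2 * int (card (D \<inter> F))"
          using gain1[of D "flip s d"] D by simp
        also have "\<dots> \<le> 2 * int (card F)"
          using True by (simp add: card_mono)
        finally show "gain D (flip s c) d \<le> 2 * int (card F)" .
      next
        fix x
        assume x: "x \<in> U \<inter> InfDeg"
        have few: "|{y. flip s c y \<noteq> c y}| <o |N x|"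
          unfolding diff1 using x by (intro finite_ordLess_N) auto
        show "hap (flip s c) x"
        proof (cases "x = s")
          case True
          show ?thesis
            unfolding True by (rule hap_flipped_few_changes[OF sX False _ few[unfolded True]]) simp
        next
          case False
          then have "hap c x" "flip s c x = c x"
            using x hap by auto
          then show ?thesis
            using x few by (intro hap_few_changes[of x c "flip s c"]) blast+
        qed
      next
        show "agree_off U c0 (flip s c)"
          using off sU by (auto simp: agree_off_def)
      qed
    next
      case inf: False
      \<comment> \<open>As \<open>F\<close> is infinite, \<open>L\<close> contains all finite-degree
        vertices of \<open>U\<close>.\<close>
      define L where "L = {v \<in> U - {s}. |N v| \<le>o |F|}"
      have "\<exists>U'. F \<inter> L \<subseteq> U' \<and> U' \<subseteq> L \<and> |U'| \<le>o |F| \<and> (\<forall>u\<in>U'. N u \<inter> L \<subseteq> U')"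
        by (rule closure_exists[OF inf]) (auto simp: L_def)
      then obtain U' where U': "F \<inter> L \<subseteq> U'" "U' \<subseteq> L" "|U'| \<le>o |F|" "\<And>u. u \<in> U' \<Longrightarrow> N u \<inter> L \<subseteq> U'"
        by blast
      have "solvable U'"
        using sol U'(2) by (auto simp: hsolvable_def L_def)
      then obtain d where d_off: "agree_off U' (flip s c) d" and d_hap: "\<And>x. x \<in> U' \<Longrightarrow> hap d x"
        and d_opt: "opt U' d"
        unfolding solvable_def by blast
      have sU': "s \<notin> U'"
        using U'(2) by (auto simp: L_def)
      have ds: "d s = (\<not> c s)" and d_eq: "\<And>v. v \<notin> U' \<Longrightarrow> v \<noteq> s \<Longrightarrow> d v = c v"
        using d_off sU' by (auto simp: agree_off_def)
      have "|{s} \<union> U'| \<le>o |F|"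
        using inf U'(3) by (intro card_of_Un_ordLeq) (auto intro: ordLess_imp_ordLeq card_of_finite_ordLess)
      moreover have "{y. d y \<noteq> c y} \<subseteq> {s} \<union> U'"
        using d_eq by auto
      ultimately have diff: "|{y. d y \<noteq> c y}| \<le>o |F|"
        using card_of_subset_ordLeq by blast
      \<comment> \<open>The untouched vertices of \<open>L\<close> see no change except possibly at
        \<open>s\<close>.\<close>
      have N_outside: "N x \<inter> U' = {}" if "x \<in> L - U'" for x
        using that U'(4) N_sym by blast
      have d_hap_U: "hap d x" if x: "x \<in> U" for x
      proof -
        \<comment> \<open>In the third case \<open>x\<close> is not in \<open>F\<close>, so if it is
          adjacent to \<open>s\<close>, the flip turns a friend into an opponent. In the fourth the
          degree of \<open>x\<close> exceeds \<open>|F|\<close>, which bounds the number of changed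
          vertices.\<close>
        consider "x = s" | "x \<in> U'" | "x \<in> L - U'" | "x \<noteq> s" "x \<notin> L"
          by blast
        then show ?thesis
        proof cases
          case 1
          then show ?thesis
            using hap_flipped_few_changes[OF sX False] ds ordLeq_ordLess_trans[OF diff F_small] by simp
        next
          case 2
          then show ?thesis
            by (rule d_hap)
        next
          case 3
          then have "x \<noteq> s" "x \<notin> F"
            using U'(1) by (auto simp: L_def)
          have dx: "d x = c x"
            using 3 d_eq \<open>x \<noteq> s\<close> by auto
          have "{y \<in> N x. d y = d x} \<subseteq> {y \<in> N x. c y = c x}"
          proof clarify
            fix y
            assume y: "y \<in> N x" "d y = d x"
            show "c y = c x"
            proof (cases "y = s")
              case True
              then have "c x = c s"
                using \<open>x \<notin> F\<close> y N_sym by (auto simp: F_def)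
              then show ?thesis
                using True by simp
            next
              case False
              then have "d y = c y"
                using y N_outside[OF 3] by (intro d_eq) auto
              then show ?thesis
                using y dx by simp
            qed
          qed
          moreover have "hap c x"
            using 3 by (intro hap) (auto simp: L_def)
          ultimately show ?thesis
            by (rule hap_mono[rotated])
        next
          case 4
          then have less: "|F| <o |N x|"
            using x by (simp add: L_def card_of_not_ordLeq)
          then have "infinite (N x)"
            using inf by (meson card_of_ordLeq_finite ordLess_imp_ordLeq)
          then have "x \<in> InfDeg"
            using finite_N by blast
          moreover have "d x = c x"
            using 4 U'(2) by (intro d_eq) auto
          ultimately show ?thesis
            using hap_few_changes[of x c d] hap x 4 ordLeq_ordLess_trans[OF diff less] by auto
        qed
      qed
      have fin_L: "U - InfDeg \<subseteq> L"
      proof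
        fix v
        assume v: "v \<in> U - InfDeg"
        then have "|N v| <o |F|"
          using inf finite_N by (intro card_of_finite_ordLess) auto
        then show "v \<in> L"
          using v sX by (auto simp: L_def intro: ordLess_imp_ordLeq)
      qed
      \<comment> \<open>\<open>U'\<close> is closed under neighbours in \<open>L\<close>, so no edge
        between finite-degree vertices of \<open>U\<close> leaves it, and the two sides can be
        treated separately.\<close>
      have "opt U d"
      proof (rule opt_glue[where k = "\<lambda>v. v \<in> U'"])
        fix x y
        assume "x \<in> U - InfDeg" "y \<in> U - InfDeg" "y \<in> N x"
        then show "(x \<in> U') = (y \<in> U')"
          using fin_L U'(4) N_sym by blast
      next
        fix i
        show "opt {x \<in> U. (x \<in> U') = i} d"
        proof (cases i)
          case True
          have "{x \<in> U. (x \<in> U') = i} = U'"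
            using True U'(2) by (auto simp: L_def)
          then show ?thesis
            using d_opt by simp
        next
          case False
          show ?thesis
            unfolding opt_def
          proof clarify
            fix D d'
            assume D: "finite D" "D \<subseteq> {x \<in> U. (x \<in> U') = i} - InfDeg" "agree_off D d d'"
            then have DL: "D \<subseteq> L - U'" and sD: "s \<notin> D"
              using False fin_L sX by auto
            \<comment> \<open>Around \<open>D\<close> the colouring \<open>d\<close> is just
              \<open>flip s c\<close>. Since \<open>D\<close> avoids \<open>F\<close>, the bound
              \<open>gain1\<close> on the gain becomes zero.\<close>
            let ?c = "\<lambda>x. if x \<in> D then d' x else c x"
            have "gain D d d' = gain D (flip s c) (flip s ?c)"
            proof (rule gain_cong)
              fix x y
              assume xy: "x \<in> D" "y \<in> insert x (N x)"
              then have "y \<notin> U'"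
                using DL N_outside by blast
              then have "d y = flip s c y"
                using ds d_eq by auto
              then show "d y = flip s c y \<and> d' y = flip s ?c y"
                using D(3) sD by (auto simp: agree_off_def)
            qed
            also have "\<dots> \<le> 2 * int (card (D \<inter> F))"
              using D by (intro gain1) (auto simp: agree_off_def)
            also have "D \<inter> F = {}"
              using DL U'(1) by auto
            finally show "gain D d d' \<le> 0"
              by simp
          qed
        qed
      qed
      moreover have "agree_off U c0 d"
        using off sU d_eq U'(2) by (auto simp: agree_off_def L_def)
      ultimately show ?thesis
        using d_hap_U by blast
    qed
  qed
qed

lemma hsolvable_remove_vertex:
  assumes "hsolvable (W - {s})"
  shows "hsolvable W"
  unfolding hsolvable_def
proof clarify
  fix U
  assume U: "U \<subseteq> W"
  then have sub: "hsolvable (U - {s})"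
    using assms unfolding hsolvable_def by blast
  show "solvable U"
  proof (cases "s \<in> U")
    case True
    then show ?thesis
      using sub solvable_insert_infinite_degree solvable_insert_finite_degree
      unfolding hsolvable_def by blast
  next
    case False
    then show ?thesis
      using sub unfolding hsolvable_def by auto
  qed
qed

lemma hsolvable_remove_finite:
  assumes "finite S" "hsolvable (W - S)"
  shows "hsolvable W"
  using assms
proof (induction S rule: finite_induct)
  case (insert s S)
  have "W - insert s S = W - S - {s}"
    by auto
  then show ?case
    using insert hsolvable_remove_vertex by metis
qed simp

section \<open>Components\<close>

definition adj_in :: "'a set \<Rightarrow> ('a \<times> 'a) set" where
  "adj_in W = {(x, y). x \<in> W \<and> y \<in> W \<and> y \<in> N x}"

definition comp :: "'a set \<Rightarrow> 'a \<Rightarrow> 'a set" where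
  "comp W v = {u. (v, u) \<in> (adj_in W)\<^sup>*}"

lemma comp_refl: "v \<in> comp W v"
  by (simp add: comp_def)

lemma comp_subset: "v \<in> W \<Longrightarrow> comp W v \<subseteq> W"
  by (auto simp: comp_def adj_in_def elim: rtranclE)

lemma sym_adj_in: "sym ((adj_in W)\<^sup>*)"
  by (rule sym_rtrancl) (auto simp: sym_def adj_in_def N_sym)

lemma comp_eq:
  assumes "u \<in> comp W v"
  shows "comp W u = comp W v"
  using assms symD[OF sym_adj_in] unfolding comp_def by (auto intro: rtrancl_trans)

lemma comp_adj: "x \<in> W \<Longrightarrow> y \<in> W \<Longrightarrow> y \<in> N x \<Longrightarrow> comp W x = comp W y"
  by (rule comp_eq[symmetric]) (auto simp: comp_def adj_in_def)

lemma comp_connected: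
  assumes "u \<in> comp W v"
  shows "(v, u) \<in> (adj_in (comp W v))\<^sup>*"
proof -
  have "(v, u) \<in> (adj_in W)\<^sup>*"
    using assms by (simp add: comp_def)
  then show ?thesis
  proof (induction rule: rtrancl_induct)
    case (step y z)
    then have "(y, z) \<in> adj_in (comp W v)"
      by (auto simp: comp_def adj_in_def intro: rtrancl_into_rtrancl)
    then show ?case
      using step.IH by simp
  qed simp
qed

text \<open>The parts of \<open>U\<close> in different components are solved independently and
  combined.\<close>

lemma hsolvable_components:
  assumes "\<And>v. v \<in> W \<Longrightarrow> hsolvable (comp W v)"
  shows "hsolvable W"
  unfolding hsolvable_def solvable_def
proof clarify
  fix U c0
  assume U: "U \<subseteq> W"
  define part where "part C = {x \<in> U. comp W x = C}" for C
  have "\<exists>c. agree_off (part C) c0 c \<and> (\<forall>x\<in>part C. hap c x) \<and> opt (part C) c" for C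
  proof (cases "part C = {}")
    case True
    then have "part C \<inter> InfDeg = {}"
      by simp
    then show ?thesis
      using solvable_locally_finite unfolding solvable_def by blast
  next
    case False
    then obtain v where "v \<in> W" "comp W v = C"
      using U by (auto simp: part_def)
    moreover have "part C \<subseteq> C"
      using comp_refl by (auto simp: part_def)
    ultimately show ?thesis
      using assms unfolding hsolvable_def solvable_def by metis
  qed
  then obtain g where g_off: "\<And>C. agree_off (part C) c0 (g C)"
    and g_hap: "\<And>C x. x \<in> part C \<Longrightarrow> hap (g C) x" and g_opt: "\<And>C. opt (part C) (g C)"
    by metis
  define c where "c v = (if v \<in> U then g (comp W v) v else c0 v)" for v
  \<comment> \<open>A neighbour of \<open>x\<close> inside \<open>U\<close> lies in the same part,
    and outside \<open>U\<close> both colourings equal \<open>c0\<close>. Other parts, where they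
    may differ, are never seen.\<close>
  have agree: "g C y = c y" if "x \<in> part C" "y \<in> insert x (N x)" for C x y
  proof (cases "y \<in> U")
    case True
    then have "comp W y = C"
      using that U comp_adj[of x W y] by (auto simp: part_def)
    then show ?thesis
      using True by (simp add: c_def)
  next
    case False
    then show ?thesis
      using g_off[of C] by (auto simp: c_def agree_off_def part_def)
  qed
  have "hap c x" if "x \<in> U" for x
  proof -
    have "x \<in> part (comp W x)"
      using that by (simp add: part_def)
    then show ?thesis
      using g_hap agree by (metis hap_cong)
  qed
  moreover have "opt U c"
  proof (rule opt_glue[where k = "comp W"])
    show "comp W x = comp W y" if "x \<in> U - InfDeg" "y \<in> U - InfDeg" "y \<in> N x" for x y
      using that U by (intro comp_adj) auto
    show "opt {x \<in> U. comp W x = C} c" for C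
      using opt_cong[OF g_opt[of C], of c] agree[of _ C] unfolding part_def by blast
  qed
  moreover have "agree_off U c0 c"
    by (simp add: agree_off_def c_def)
  ultimately show "\<exists>c. agree_off U c0 c \<and> (\<forall>x\<in>U. hap c x) \<and> opt U c"
    by blast
qed

section \<open>Construction of the comb\<close>

lemma path_in:
  assumes "(u, v) \<in> (adj_in W)\<^sup>*" "u \<in> W"
  shows "\<exists>p. p \<noteq> [] \<and> hd p = u \<and> last p = v \<and> set p \<subseteq> W \<and> distinct p
    \<and> successively (\<lambda>x y. {x, y} \<in> E) p"
  using assms(1)
proof (induction rule: rtrancl_induct)
  case base
  then show ?case
    using assms(2) by (intro exI[of _ "[u]"]) auto
next
  case (step y z)
  then obtain p where p: "p \<noteq> []" "hd p = u" "last p = y" "set p \<subseteq> W" "distinct p"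
    "successively (\<lambda>x y. {x, y} \<in> E) p"
    by blast
  have z: "z \<in> W" "{y, z} \<in> E"
    using step.hyps(2) by (auto simp: adj_in_def neighbours_def)
  show ?case
  proof (cases "z \<in> set p")
    case True
    then obtain q1 q2 where q: "p = q1 @ z # q2"
      by (meson split_list)
    have "hd (q1 @ [z]) = u"
      using p(2) q by (cases q1) auto
    then show ?thesis
      using p q by (intro exI[of _ "q1 @ [z]"]) (auto simp: successively_append_iff)
  next
    case False
    then show ?thesis
      using p z by (intro exI[of _ "p @ [z]"]) (auto simp: successively_append_iff)
  qed
qed

text \<open>\<open>Q\<close> will be \<open>hsolvable\<close>. A connected bad set \<open>C\<close>
  contains a vertex \<open>x\<close> of infinite degree; deleting a path \<open>p\<close> from
  \<open>v\<close> to \<open>x\<close> leaves a bad component \<open>C'\<close>. Some edge joins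
  \<open>p\<close> to \<open>C'\<close>: the initial part \<open>A\<close> of \<open>p\<close> up to
  that edge extends the ray, and the rest \<open>B\<close> leads to the tooth
  \<open>x\<close>.\<close>

lemma comb_step:
  assumes base: "\<forall>W. W \<inter> InfDeg = {} \<longrightarrow> Q W"
    and comps: "\<forall>W S. finite S \<longrightarrow> (\<forall>v\<in>W - S. Q (comp (W - S) v)) \<longrightarrow> Q W"
    and C: "v \<in> C" "\<forall>u\<in>C. (v, u) \<in> (adj_in C)\<^sup>*" "\<not> Q C"
  shows "\<exists>C' v' A B. v' \<in> C' \<and> (\<forall>u\<in>C'. (v', u) \<in> (adj_in C')\<^sup>*) \<and> \<not> Q C' \<and>
    A \<noteq> [] \<and> hd A = v \<and> distinct (A @ B) \<and> set (A @ B) \<subseteq> C \<and> C' \<subseteq> C - set (A @ B) \<and>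
    successively (\<lambda>x y. {x, y} \<in> E) (A @ B) \<and> last (A @ B) \<in> InfDeg \<and> {last A, v'} \<in> E"
proof -
  obtain x where x: "x \<in> C" "x \<in> InfDeg"
    using base C(3) by blast
  obtain p where p: "p \<noteq> []" "hd p = v" "last p = x" "set p \<subseteq> C" "distinct p"
    "successively (\<lambda>x y. {x, y} \<in> E) p"
    using path_in[OF C(2)[rule_format, OF x(1)] C(1)] by blast
  obtain w where w: "w \<in> C - set p" "\<not> Q (comp (C - set p) w)"
    using comps C(3) by (metis finite_set)
  define C' where "C' = comp (C - set p) w"
  have C'_sub: "C' \<subseteq> C - set p"
    unfolding C'_def using w(1) by (rule comp_subset)
  have "v \<notin> C'"
    using C'_sub p(1,2) by auto
  \<comment> \<open>A walk in \<open>C\<close> from \<open>v\<close> outside \<open>C'\<close> to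
    \<open>w\<close> inside must enter \<open>C'\<close> somewhere.\<close>
  have "\<exists>a b. a \<notin> C' \<and> b \<in> C' \<and> (a, b) \<in> adj_in C"
  proof (rule ccontr)
    assume none: "\<not> ?thesis"
    have "(v, w) \<in> (adj_in C)\<^sup>*"
      using C(2) w(1) by auto
    then have "w \<notin> C'"
      by (induction rule: rtrancl_induct) (use \<open>v \<notin> C'\<close> none in auto)
    then show False
      by (simp add: C'_def comp_refl)
  qed
  then obtain a b where ab: "a \<notin> C'" "b \<in> C'" "a \<in> C" "b \<in> N a"
    by (auto simp: adj_in_def)
  have "comp (C - set p) b = C'"
    using comp_eq ab(2) unfolding C'_def by blast
  have "a \<in> set p"
  proof (rule ccontr)
    assume "a \<notin> set p"
    then have "comp (C - set p) a = C'"
      using ab C'_sub comp_adj[of a "C - set p" b] \<open>comp (C - set p) b = C'\<close> by auto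
    then show False
      using ab(1) comp_refl by blast
  qed
  then obtain ys zs where ys: "p = ys @ a # zs"
    by (meson split_list)
  define A where "A = ys @ [a]"
  have A: "p = A @ zs" "A \<noteq> []" "last A = a" "hd A = v"
    using ys p(2) by (auto simp: A_def) (cases ys; simp)
  have conn: "\<forall>u\<in>C'. (b, u) \<in> (adj_in C')\<^sup>*"
    using comp_connected[of _ "C - set p" b] \<open>comp (C - set p) b = C'\<close> by simp
  have "{last A, b} \<in> E"
    using ab(4) A(3) by (simp add: neighbours_def)
  then have "b \<in> C' \<and> (\<forall>u\<in>C'. (b, u) \<in> (adj_in C')\<^sup>*) \<and> \<not> Q C' \<and>
    A \<noteq> [] \<and> hd A = v \<and> distinct (A @ zs) \<and> set (A @ zs) \<subseteq> C \<and> C' \<subseteq> C - set (A @ zs) \<and>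
    successively (\<lambda>x y. {x, y} \<in> E) (A @ zs) \<and> last (A @ zs) \<in> InfDeg \<and> {last A, b} \<in> E"
    using ab(2) conn w(2) A(2,4) p x(2) C'_sub unfolding C'_def[symmetric] A(1)[symmetric] by simp
  then show ?thesis
    by blast
qed

text \<open>Dependent choice iterates \<open>comb_step\<close> on pairs of a bad connected set and a
  root in it. The sets shrink and avoid all earlier paths, so the segments \<open>A n\<close> form a
  ray and the remainders branch off disjointly.\<close>

lemma comb_exists:
  assumes base: "\<forall>W. W \<inter> InfDeg = {} \<longrightarrow> Q W"
    and comps: "\<forall>W S. finite S \<longrightarrow> (\<forall>v\<in>W - S. Q (comp (W - S) v)) \<longrightarrow> Q W"
    and "\<not> Q V"
  shows "\<exists>r P. is_comb V E r P \<and> (\<forall>t\<in>teeth P. infinite_degree E t)"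
proof -
  define ok where "ok s \<longleftrightarrow> (case s of (C, v) \<Rightarrow> C \<subseteq> V \<and> v \<in> C \<and> (\<forall>u\<in>C. (v, u) \<in> (adj_in C)\<^sup>*) \<and> \<not> Q C)"
    for s
  define R where "R s s' A B \<longleftrightarrow> (case s of (C, v) \<Rightarrow> case s' of (C', v') \<Rightarrow>
    A \<noteq> [] \<and> hd A = v \<and> distinct (A @ B) \<and> set (A @ B) \<subseteq> C \<and> C' \<subseteq> C - set (A @ B) \<and>
    successively (\<lambda>x y. {x, y} \<in> E) (A @ B) \<and> last (A @ B) \<in> InfDeg \<and> {last A, v'} \<in> E)" for s s' A B
  have "\<exists>s. ok s"
  proof -
    obtain v where v: "v \<in> V" "\<not> Q (comp V v)"
      using comps assms(3) by (metis Diff_empty finite.emptyI)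
    then have "ok (comp V v, v)"
      using comp_subset[of v V] comp_refl[of v V] comp_connected[of _ V v] by (auto simp: ok_def)
    then show ?thesis ..
  qed
  moreover have "\<exists>s'. ok s' \<and> (\<exists>A B. R s s' A B)" if "ok s" for s
  proof -
    obtain C v where s: "s = (C, v)"
      by (cases s)
    then have Cv: "C \<subseteq> V" "v \<in> C" "\<forall>u\<in>C. (v, u) \<in> (adj_in C)\<^sup>*" "\<not> Q C"
      using that by (auto simp: ok_def)
    obtain C' v' A B where *: "v' \<in> C'" "\<forall>u\<in>C'. (v', u) \<in> (adj_in C')\<^sup>*" "\<not> Q C'"
      "A \<noteq> [] \<and> hd A = v \<and> distinct (A @ B) \<and> set (A @ B) \<subseteq> C \<and> C' \<subseteq> C - set (A @ B) \<and>
      successively (\<lambda>x y. {x, y} \<in> E) (A @ B) \<and> last (A @ B) \<in> InfDeg \<and> {last A, v'} \<in> E"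
      using comb_step[of Q, OF base comps Cv(2,3,4)] by (elim exE conjE) blast
    have "ok (C', v')"
      using * Cv(1) by (auto simp: ok_def)
    moreover have "R s (C', v') A B"
      using *(4) unfolding R_def s by simp
    ultimately show ?thesis
      by blast
  qed
  ultimately obtain f where f: "\<And>n. ok (f n)" "\<And>n. \<exists>A B. R (f n) (f (Suc n)) A B"
    using dependent_nat_choice[of "\<lambda>_. ok" "\<lambda>_ s s'. \<exists>A B. R s s' A B"] by blast
  then obtain A B where AB: "\<And>n. R (f n) (f (Suc n)) (A n) (B n)"
    by metis
  define C where "C n = fst (f n)" for n
  have v: "hd (A n) = snd (f n)" "{last (A n), snd (f (Suc n))} \<in> E" for n
    using AB[of n] by (auto simp: R_def split: prod.splits)
  have A: "A n \<noteq> []" "distinct (A n @ B n)" "set (A n @ B n) \<subseteq> C n"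
    "C (Suc n) \<subseteq> C n - set (A n @ B n)" "successively (\<lambda>x y. {x, y} \<in> E) (A n @ B n)"
    "last (A n @ B n) \<in> InfDeg" for n
    using AB[of n] by (auto simp: R_def C_def split: prod.splits)
  have CV: "C n \<subseteq> V" for n
    using f(1)[of n] by (auto simp: ok_def C_def split: prod.splits)
  have C_Suc: "C (Suc n) \<subseteq> C n" for n
    using A(4)[of n] by blast
  have C_anti: "C n \<subseteq> C m" if "m \<le> n" for m n
    using C_Suc that by (rule lift_Suc_antimono_le)
  have disj: "set (A m @ B m) \<inter> set (A n @ B n) = {}" if "m < n" for m n
    using A(3)[of n] A(4)[of m] C_anti[of "Suc m" n] that by auto
  have disj': "set (A m @ B m) \<inter> set (A n @ B n) = {}" if "m \<noteq> n" for m n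
    using disj[of m n] disj[of n m] that by (metis inf_commute nat_neq_iff)
  obtain r where r: "is_ray V E r" "range r = (\<Union>n. set (A n))"
  proof -
    have "\<exists>r. is_ray V E r \<and> range r = (\<Union>n. set (A n))"
    proof (rule ray_of_segments)
      show "A n \<noteq> []" "set (A n) \<subseteq> V" "distinct (A n)" "successively (\<lambda>u v. {u, v} \<in> E) (A n)" for n
        using A[of n] CV[of n] by (auto simp: successively_append_iff)
      show "set (A m) \<inter> set (A n) = {}" if "m < n" for m n
        using disj[OF that] by auto
      show "{last (A n), hd (A (Suc n))} \<in> E" for n
        using v[of n] v(1)[of "Suc n"] by simp
    qed
    then show thesis
      using that by blast
  qed
  \<comment> \<open>The path starts at the last vertex of \<open>A n\<close>, where it meets the
    ray; it is trivial if \<open>B n\<close> is empty.\<close>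
  define p where "p n = last (A n) # B n" for n
  have split: "A n @ B n = butlast (A n) @ p n" for n
    using A(1)[of n] by (simp add: p_def)
  have p_sub: "set (p n) \<subseteq> set (A n @ B n)" for n
    unfolding split by auto
  have p_disj: "set (p m) \<inter> set (p n) = {}" if "m \<noteq> n" for m n
    using disj'[OF that] p_sub[of m] p_sub[of n] by blast
  have p_path: "is_path V E (p n)" for n
    using A(2)[of n] A(3)[of n] A(5)[of n] CV[of n] unfolding split is_path_def
    by (auto simp: successively_append_iff p_def)
  have p_ray: "set (p n) \<inter> range r = {hd (p n)}" for n
  proof -
    have only: "x = last (A n)" if x: "x \<in> set (p n)" "x \<in> set (A m)" for x m
    proof (cases "m = n")
      case True
      then show ?thesis
        using A(2)[of n] x by (auto simp: p_def)
    next
      case False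
      then show ?thesis
        using disj'[of m n] p_sub[of n] x by auto
    qed
    have "last (A n) \<in> set (p n)" "last (A n) \<in> set (A n)"
      using A(1)[of n] by (auto simp: p_def)
    then have "set (p n) \<inter> (\<Union>m. set (A m)) = {last (A n)}"
      by (intro equalityI subsetI) (use only in blast)+
    then show ?thesis
      by (simp add: r(2) p_def)
  qed
  \<comment> \<open>The paths are nonempty and disjoint for distinct indices, hence there are
    infinitely many.\<close>
  have "inj p"
    by (rule injI) (metis p_disj p_def inf.idem list.distinct(1) set_empty)
  then have "infinite (range p)"
    using finite_imageD by blast
  moreover have "set a \<inter> set b = {}" if ab: "a \<in> range p" "b \<in> range p" "a \<noteq> b" for a b
  proof -
    obtain m n where "a = p m" "b = p n"
      using ab(1,2) by blast
    then show ?thesis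
      using ab(3) p_disj[of m n] by (cases "m = n") simp_all
  qed
  moreover have "is_path V E a \<and> set a \<inter> range r = {hd a}" if a: "a \<in> range p" for a
  proof -
    obtain n where "a = p n"
      using a by blast
    then show ?thesis
      using p_path p_ray by simp
  qed
  ultimately have "is_comb V E r (range p)"
    unfolding is_comb_def using r(1) by (intro conjI ballI impI) simp_all
  moreover have "last (p n) \<in> InfDeg" for n
    using A(6)[of n] unfolding split by (simp add: p_def)
  ultimately show ?thesis
    by (intro exI[of _ r] exI[of _ "range p"]) (auto simp: teeth_def InfDeg_def)
qed

end

theorem theorem2:
  fixes V :: "'a set" and E :: "'a set set"
  assumes "simple_graph V E"
    and "\<not> (\<exists>r P. is_comb V E r P \<and> (\<forall>t\<in>teeth P. infinite_degree E t))"
  shows "\<exists>\<pi>. unfriendly_partition V E \<pi>"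
proof -
  interpret sgraph V E
    by standard fact
  have "hsolvable V"
  proof (rule ccontr)
    assume "\<not> hsolvable V"
    then have "\<exists>r P. is_comb V E r P \<and> (\<forall>t\<in>teeth P. infinite_degree E t)"
    proof (rule comb_exists[rotated 2])
      show "\<forall>W. W \<inter> InfDeg = {} \<longrightarrow> hsolvable W"
        using solvable_locally_finite unfolding hsolvable_def by blast
      show "\<forall>W S. finite S \<longrightarrow> (\<forall>v\<in>W - S. hsolvable (comp (W - S) v)) \<longrightarrow> hsolvable W"
        using hsolvable_remove_finite hsolvable_components by blast
    qed
    then show False
      using assms(2) by blast
  qed
  then obtain c where c: "\<forall>x\<in>V. hap c x"
    unfolding hsolvable_def solvable_def by blast
  define \<pi> :: "'a \<Rightarrow> nat" where "\<pi> v = of_bool (c v)" for v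
  have "friends E \<pi> x = {y \<in> N x. c y = c x}" "opponents E \<pi> x = {y \<in> N x. c y \<noteq> c x}" for x
    by (auto simp: friends_def opponents_def \<pi>_def)
  then have "unfriendly_partition V E \<pi>"
    using c by (auto simp: unfriendly_partition_def happy_def hap_def \<pi>_def)
  then show ?thesis
    by blast
qed

end
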